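(* Let $\{X_{n,k}:n\in\mathbb{N},\ k=1,\ldots,K_n\}$ be a rowwise independent array of random elements in the torus $\mathbb{T}$. Suppose that there exist an element $a\in\mathbb{T}$ and a nonnegative real number $b$ such that (i) $\exp\left\{i\sum_{k=1}^{K_n}\mathrm{E}\,\arg(X_{n,k})\right\}\to a$ as $n\to\infty$, (ii) $\sum_{k=1}^{K_n}\mathrm{Var}\,\arg(X_{n,k})\to b$ as $n\to\infty$, (iii) $\sum_{k=1}^{K_n}\mathrm{P}(|\arg(X_{n,k})|>\varepsilon)\to0$ as $n\to\infty$ for all $\varepsilon>0$. Then the array $\{X_{n,k}\}$ is infinitesimal, and the distribution of $\sum_{k=1}^{K_n}X_{n,k}$ converges weakly to $\delta_a*\gamma_{\psi_b}$ as $n\to\infty$.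
   Context: $\mathbb{T}=\{e^{ix}:-\pi\le x<\pi\}$ is the circle group under multiplication of complex numbers, with identity $e=1$; $\sum_{k=1}^{K_n}X_{n,k}$ denotes the group operation applied to $X_{n,1},\ldots,X_{n,K_n}$, i.e. the product of these complex numbers. $\mathbb{N}$ is the set of positive integers. $\arg:\mathbb{T}\to[-\pi,\pi)$ is given by $\arg(e^{ix})=x$ for $-\pi\le x<\pi$. Rowwise independent: for each $n$, $X_{n,1},\ldots,X_{n,K_n}$ are independent. Infinitesimal: $\lim_{n\to\infty}\max_{1\le k\le K_n}\mathrm{P}(X_{n,k}\in\mathbb{T}\setminus U)=0$ for every Borel set $U$ containing an open set that contains $e$. $\delta_a$ is the Dirac measure at $a$ and $*$ is convolution. $\gamma_{\psi_b}$ is the (existing, unique) probability measure on $\mathbb{T}$ with $\int_{\mathbb{T}}y^\ell\,d\gamma_{\psi_b}(y)=e^{-b\ell^2/2}$ for all $\ell\in\mathbb{Z}$. *)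

theory Defs
  imports "HOL-Probability.Probability"
begin

definition torus :: "complex set" where
  "torus = sphere 0 1"

definition torus_borel :: "complex measure" where
  "torus_borel = restrict_space borel torus"

text \<open>
  The argument with values in \<open>[-pi, pi)\<close>.  The library function \<^const>\<open>Arg\<close> takes values in
  \<open>(-pi, pi]\<close>; the two differ at \<open>-1\<close>.
\<close>

definition torus_arg :: "complex \<Rightarrow> real" where
  "torus_arg z = (THE x. - pi \<le> x \<and> x < pi \<and> cis x = z)"

lemma torus_arg_cis:
  assumes "- pi \<le> x" "x < pi"
  shows "torus_arg (cis x) = x"
  unfolding torus_arg_def
proof (rule the_equality)
  show "- pi \<le> x \<and> x < pi \<and> cis x = cis x"
    using assms by simp
next
  fix y assume y: "- pi \<le> y \<and> y < pi \<and> cis y = cis x"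
  then have "cis (y - x) = 1"
    by (simp flip: cis_divide)
  then have "cos (y - x) = 1"
    by (metis cis.sel(1) one_complex.sel(1))
  then obtain n :: int where n: "y - x = of_int n * 2 * pi"
    by (auto simp: cos_one_2pi_int)
  have "\<bar>y - x\<bar> < 2 * pi"
    using y assms by linarith
  then have "\<bar>of_int n\<bar> * (2 * pi) < 1 * (2 * pi)"
    by (simp add: n abs_mult)
  then have "\<bar>of_int n :: real\<bar> < 1"
    by (simp only: mult_less_cancel_right) auto
  then have "n = 0"
    by linarith
  with n show "y = x"
    by simp
qed

definition torus_infinitesimal ::
  "(nat \<Rightarrow> 'a measure) \<Rightarrow> (nat \<Rightarrow> nat) \<Rightarrow> (nat \<Rightarrow> nat \<Rightarrow> 'a \<Rightarrow> complex) \<Rightarrow> bool" where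
  "torus_infinitesimal M K X \<longleftrightarrow>
    (\<forall>U\<in>sets torus_borel.
      (\<exists>V. openin (top_of_set torus) V \<and> 1 \<in> V \<and> V \<subseteq> U) \<longrightarrow>
      (\<lambda>n. MAX k\<in>{1..K n}. measure (M n) {\<omega>\<in>space (M n). X n k \<omega> \<in> torus - U})
        \<longlonglongrightarrow> 0)"

text \<open>
  The library's \<^const>\<open>convolution\<close> is with respect to addition; here the group operation is
  multiplication.
\<close>

definition torus_convolution :: "complex measure \<Rightarrow> complex measure \<Rightarrow> complex measure" where
  "torus_convolution \<mu> \<nu> = distr (\<mu> \<Otimes>\<^sub>M \<nu>) torus_borel (\<lambda>(x, y). x * y)"

text \<open>
  The library's \<^const>\<open>weak_conv_m\<close> is formulated with distribution functions and only
  applies to measures on the reals.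
\<close>

definition torus_weak_conv :: "(nat \<Rightarrow> complex measure) \<Rightarrow> complex measure \<Rightarrow> bool" where
  "torus_weak_conv \<mu> \<nu> \<longleftrightarrow>
    (\<forall>f :: complex \<Rightarrow> real. continuous_on torus f \<and> bounded (f ` torus) \<longrightarrow>
      (\<lambda>n. \<integral>x. f x \<partial>\<mu> n) \<longlonglongrightarrow> (\<integral>x. f x \<partial>\<nu>))"

definition torus_gauss :: "real \<Rightarrow> complex measure" where
  "torus_gauss b = (THE \<gamma>. prob_space \<gamma> \<and> sets \<gamma> = sets torus_borel \<and>
    (\<forall>l :: int. (\<integral>y. y powi l \<partial>\<gamma>) = complex_of_real (exp (- b * (of_int l)\<^sup>2 / 2))))"

end

theory Submission
  imports Defs
begin

text \<open>
  By Stone--Weierstrass, trigonometric polynomials are uniformly dense in the continuous functions on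
  the torus, so weak convergence follows from convergence of Fourier coefficients, and a probability
  measure is determined by them; in particular the Gaussian measure is the law of
  \<open>cis (sqrt b * N)\<close> with \<open>N\<close> standard normal.  By independence the \<open>l\<close>-th Fourier coefficient of the
  product is \<open>\<Prod>k. cis (l * E Y\<^sub>k) * E (cis (l * Z\<^sub>k))\<close>, where \<open>Y\<^sub>k = arg X\<^sub>k\<close> and
  \<open>Z\<^sub>k = Y\<^sub>k - E Y\<^sub>k\<close>.  Replacing each factor \<open>E (cis (l * Z\<^sub>k))\<close> by \<open>exp (- l\<^sup>2 * Var Y\<^sub>k / 2)\<close> costs
  at most a constant multiple of \<open>\<Sum>k. E \<bar>Z\<^sub>k\<bar>\<^sup>3\<close>.  Since the arguments are bounded, this sum is at most
  \<open>3 * \<delta> * (\<Sum>k. Var Y\<^sub>k) + (2 * pi)\<^sup>3 * (\<Sum>k. P (\<bar>Y\<^sub>k\<bar> > \<delta>))\<close>, hence tends to \<open>0\<close> by (ii) and (iii).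
\<close>

section \<open>The Borel space of the torus\<close>

lemma space_torus_borel [simp]: "space torus_borel = torus"
  by (simp add: torus_borel_def space_restrict_space)

lemma sets_torus_borel: "sets torus_borel = (\<inter>) torus ` sets borel"
  by (simp add: torus_borel_def sets_restrict_space)

lemma space_eq_torus: "sets \<mu> = sets torus_borel \<Longrightarrow> space \<mu> = torus"
  using sets_eq_imp_space_eq[of \<mu> torus_borel] by simp

lemma compact_torus: "compact torus"
  by (simp add: torus_def)

lemma torus_not_zero: "z \<in> torus \<Longrightarrow> z \<noteq> 0"
  by (auto simp: torus_def)

lemma norm_torus: "z \<in> torus \<Longrightarrow> norm z = 1"
  by (auto simp: torus_def)

lemma cis_in_torus [simp]: "cis x \<in> torus"
  by (simp add: torus_def)

lemma measurable_torus_borelI: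
  assumes "f \<in> borel_measurable M" "\<And>x. x \<in> space M \<Longrightarrow> f x \<in> torus"
  shows "f \<in> measurable M torus_borel"
  using assms unfolding torus_borel_def by (auto intro: measurable_restrict_space2)

lemma borel_measurable_torus:
  assumes "f \<in> measurable M torus_borel"
  shows "f \<in> borel_measurable M"
  using assms unfolding torus_borel_def by (simp add: measurable_restrict_space2_iff)

lemma borel_measurable_continuous_torus:
  fixes f :: "complex \<Rightarrow> 'b::topological_space"
  assumes "continuous_on torus f"
  shows "f \<in> borel_measurable torus_borel"
  using assms unfolding torus_borel_def by (rule borel_measurable_continuous_on_restrict)

section \<open>Trigonometric polynomials\<close>

text \<open>Finite sums of integer powers of \<open>z\<close>. The equations are demanded only on
  the torus, so that \<open>cnj z\<close> counts as \<open>z powi (-1)\<close> there and the class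
  is closed under agreement on the torus.\<close>

inductive trig_poly :: "(complex \<Rightarrow> complex) \<Rightarrow> bool" where
  monom: "(\<And>z. z \<in> torus \<Longrightarrow> f z = c * z powi l) \<Longrightarrow> trig_poly f"
| add: "trig_poly f \<Longrightarrow> trig_poly g \<Longrightarrow> (\<And>z. z \<in> torus \<Longrightarrow> h z = f z + g z) \<Longrightarrow> trig_poly h"

text \<open>Serves as the monomial case of the product: exponents add, since points of the torus are
  nonzero.\<close>

lemma trig_poly_monom_mult:
  assumes "trig_poly f" "\<And>z. z \<in> torus \<Longrightarrow> h z = c * z powi l * f z"
  shows "trig_poly h"
  using assms
proof (induction arbitrary: h)
  case (monom f d m)
  show ?case
    by (rule trig_poly.monom[of _ "c * d" "l + m"])
       (auto simp: monom power_int_add torus_not_zero)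
next
  case (add f g k)
  show ?case
    by (rule trig_poly.add[OF add.IH(1)[OF refl] add.IH(2)[OF refl]])
       (simp add: add.hyps(3) add.prems algebra_simps)
qed

lemma trig_poly_mult:
  assumes "trig_poly f" "trig_poly g" "\<And>z. z \<in> torus \<Longrightarrow> h z = f z * g z"
  shows "trig_poly h"
  using assms
proof (induction arbitrary: h)
  case (monom f d m)
  show ?case
    by (rule trig_poly_monom_mult[OF \<open>trig_poly g\<close>, of h d m]) (simp add: monom)
next
  case (add f f' k)
  show ?case
    by (rule trig_poly.add[OF add.IH(1)[OF \<open>trig_poly g\<close> refl] add.IH(2)[OF \<open>trig_poly g\<close> refl]])
       (simp add: add.hyps(3) add.prems algebra_simps)
qed

text \<open>The bridge from Stone--Weierstrass, which yields polynomials in the real coordinates, to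
  Fourier coefficients: on the torus both coordinates are combinations of \<open>z\<close> and
  \<open>z powi (-1)\<close>, and the class is closed under sums and products.\<close>

lemma trig_poly_real_polynomial_function:
  fixes p :: "complex \<Rightarrow> real"
  assumes "real_polynomial_function p"
  shows "trig_poly (\<lambda>z. complex_of_real (p z))"
  using assms
proof induction
  case (linear f)
  interpret bounded_linear f by fact
  \<comment> \<open>A real-linear functional on the plane is determined by its values at
    \<open>1\<close> and \<open>\<i>\<close>.\<close>
  have eq: "f z = Re z * f 1 + Im z * f \<i>" for z
  proof -
    have "f z = f (Re z *\<^sub>R 1 + Im z *\<^sub>R \<i>)"
      by (rule arg_cong[where f=f]) (simp add: complex_eq_iff)
    then show ?thesis by (simp only: add scaleR) simp
  qed
  have inv: "z powi (-1) = cnj z" if "z \<in> torus" for z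
    using that divide_conv_cnj[of z 1] by (simp add: norm_torus power_int_minus inverse_eq_divide)
  show ?case
  proof (rule trig_poly.add)
    \<comment> \<open>The coefficients come from \<open>Re z = (z + cnj z) / 2\<close> and
      \<open>Im z = (z - cnj z) / (2 * \<i>)\<close>.\<close>
    show "trig_poly (\<lambda>z. (f 1 / 2 - \<i> * f \<i> / 2) * z powi 1)"
         "trig_poly (\<lambda>z. (f 1 / 2 + \<i> * f \<i> / 2) * z powi (-1))"
      by (rule trig_poly.monom, rule refl)+
    show "complex_of_real (f z) = (f 1 / 2 - \<i> * f \<i> / 2) * z powi 1
        + (f 1 / 2 + \<i> * f \<i> / 2) * z powi (-1)" if "z \<in> torus" for z
      unfolding inv[OF that] eq[of z] by (simp add: complex_eq_iff algebra_simps)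
  qed
next
  case (const c)
  show ?case by (rule trig_poly.monom[of _ "of_real c" 0]) simp
next
  case (add f g)
  show ?case by (rule trig_poly.add[OF add.IH]) simp
next
  case (mult f g)
  show ?case by (rule trig_poly_mult[OF mult.IH]) simp
qed

lemma integrable_trig_poly:
  assumes "trig_poly f" "finite_measure \<mu>" "sets \<mu> = sets torus_borel"
  shows "integrable \<mu> f"
  using assms(1)
proof induction
  case (monom f c l)
  interpret finite_measure \<mu> by fact
  have sp: "space \<mu> = torus"
    using assms(3) by (rule space_eq_torus)
  have "continuous_on torus (\<lambda>z. c * z powi l)"
    by (intro continuous_intros) (auto simp: torus_not_zero)
  then have "(\<lambda>z. c * z powi l) \<in> borel_measurable \<mu>"
    using borel_measurable_continuous_torus measurable_cong_sets[OF assms(3) refl] by blast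
  moreover have "AE x in \<mu>. norm (c * x powi l) \<le> norm c"
    by (intro AE_I2) (simp add: sp norm_torus norm_mult norm_power_int)
  ultimately have "integrable \<mu> (\<lambda>z. c * z powi l)"
    by (intro integrable_const_bound)
  moreover have "integrable \<mu> f \<longleftrightarrow> integrable \<mu> (\<lambda>z. c * z powi l)"
    by (rule Bochner_Integration.integrable_cong) (auto simp: sp monom)
  ultimately show ?case by simp
next
  case (add f g h)
  have sp: "space \<mu> = torus"
    using assms(3) by (rule space_eq_torus)
  have "integrable \<mu> (\<lambda>z. f z + g z)"
    using add.IH by simp
  moreover have "integrable \<mu> h \<longleftrightarrow> integrable \<mu> (\<lambda>z. f z + g z)"
    by (rule Bochner_Integration.integrable_cong) (auto simp: sp add)
  ultimately show ?case by simp
qed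

section \<open>Weak convergence and uniqueness through Fourier coefficients\<close>

text \<open>Linearity carries convergence of the coefficients over to finite sums. The
  \<open>\<mu> n\<close> are constrained only eventually because the rows of the array are specified
  only from \<open>n = 1\<close> on.\<close>

lemma tendsto_integral_trig_poly:
  assumes "trig_poly f"
    and \<mu>: "\<forall>\<^sub>F n in F. finite_measure (\<mu> n) \<and> sets (\<mu> n) = sets torus_borel"
    and \<nu>: "finite_measure \<nu>" "sets \<nu> = sets torus_borel"
    and lim: "\<And>l::int. ((\<lambda>n. \<integral>z. z powi l \<partial>\<mu> n) \<longlongrightarrow> (\<integral>z. z powi l \<partial>\<nu>)) F"
  shows "((\<lambda>n. \<integral>z. f z \<partial>\<mu> n) \<longlongrightarrow> (\<integral>z. f z \<partial>\<nu>)) F"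
  using assms(1)
proof induction
  case (monom f c l)
  have eq: "(\<integral>z. f z \<partial>\<rho>) = c * (\<integral>z. z powi l \<partial>\<rho>)" if "sets \<rho> = sets torus_borel" for \<rho>
  proof -
    have "space \<rho> = torus"
      by (rule space_eq_torus) (fact that)+
    then have "(\<integral>z. f z \<partial>\<rho>) = (\<integral>z. c * z powi l \<partial>\<rho>)"
      by (intro Bochner_Integration.integral_cong) (auto simp: monom)
    then show ?thesis by simp
  qed
  have "((\<lambda>n. c * (\<integral>z. z powi l \<partial>\<mu> n)) \<longlongrightarrow> c * (\<integral>z. z powi l \<partial>\<nu>)) F"
    by (intro tendsto_intros lim)
  then show ?case
    unfolding eq[OF \<nu>(2)]
    by (rule Lim_transform_eventually) (use \<mu> in eventually_elim, simp add: eq)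
next
  case (add f g h)
  have eq: "(\<integral>z. h z \<partial>\<rho>) = (\<integral>z. f z \<partial>\<rho>) + (\<integral>z. g z \<partial>\<rho>)"
    if "finite_measure \<rho>" "sets \<rho> = sets torus_borel" for \<rho>
  proof -
    have "space \<rho> = torus"
      by (rule space_eq_torus) (fact that)+
    then have "(\<integral>z. h z \<partial>\<rho>) = (\<integral>z. f z + g z \<partial>\<rho>)"
      by (intro Bochner_Integration.integral_cong) (auto simp: add)
    then show ?thesis
      using that add.hyps by (simp add: integrable_trig_poly)
  qed
  have "((\<lambda>n. (\<integral>z. f z \<partial>\<mu> n) + (\<integral>z. g z \<partial>\<mu> n)) \<longlongrightarrow> (\<integral>z. f z \<partial>\<nu>) + (\<integral>z. g z \<partial>\<nu>)) F"
    by (intro tendsto_intros add.IH)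
  then show ?case
    unfolding eq[OF \<nu>]
    by (rule Lim_transform_eventually) (use \<mu> in eventually_elim, simp add: eq)
qed

text \<open>A three-part estimate: \<open>f\<close> is uniformly within \<open>e / 3\<close> of a
  polynomial \<open>p\<close>, which changes each integral by at most \<open>e / 3\<close> because
  the measures have mass one, while the integrals of \<open>p\<close> converge.\<close>

lemma torus_weak_convI:
  assumes \<mu>: "\<forall>\<^sub>F n in sequentially. prob_space (\<mu> n) \<and> sets (\<mu> n) = sets torus_borel"
    and \<nu>: "prob_space \<nu>" "sets \<nu> = sets torus_borel"
    and lim: "\<And>l::int. (\<lambda>n. \<integral>z. z powi l \<partial>\<mu> n) \<longlonglongrightarrow> (\<integral>z. z powi l \<partial>\<nu>)"
  shows "torus_weak_conv \<mu> \<nu>"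
  unfolding torus_weak_conv_def
proof (intro allI impI)
  fix f :: "complex \<Rightarrow> real"
  assume "continuous_on torus f \<and> bounded (f ` torus)"
  then have cont: "continuous_on torus f" and bdd: "bounded (f ` torus)" by auto
  show "(\<lambda>n. \<integral>x. f x \<partial>\<mu> n) \<longlonglongrightarrow> (\<integral>x. f x \<partial>\<nu>)"
  proof (rule tendstoI)
    fix e :: real assume "e > 0"
    then obtain p where p: "real_polynomial_function p" "\<And>x. x \<in> torus \<Longrightarrow> \<bar>f x - p x\<bar> < e / 3"
      using Stone_Weierstrass_real_polynomial_function[OF compact_torus cont, of "e / 3"] by auto
    have near: "\<bar>(\<integral>x. f x \<partial>\<rho>) - (\<integral>x. p x \<partial>\<rho>)\<bar> \<le> e / 3"
      if "prob_space \<rho>" "sets \<rho> = sets torus_borel" for \<rho>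
    proof -
      interpret prob_space \<rho> by fact
      have sp: "space \<rho> = torus"
        by (rule space_eq_torus) (fact that)+
      obtain B where B: "\<And>x. x \<in> torus \<Longrightarrow> norm (f x) \<le> B"
        using bdd by (auto simp: bounded_iff)
      have "f \<in> borel_measurable \<rho>"
        using borel_measurable_continuous_torus[OF cont] measurable_cong_sets[OF that(2) refl] by blast
      then have f: "integrable \<rho> f"
        using B by (intro integrable_const_bound[where B=B] AE_I2) (auto simp: sp)
      \<comment> \<open>Trigonometric polynomials are complex-valued, so integrability of the real
        \<open>p\<close> is read off its complex embedding.\<close>
      have "integrable \<rho> (\<lambda>x. complex_of_real (p x))"
        using that(2) by (intro integrable_trig_poly trig_poly_real_polynomial_function p) unfold_locales
      then have p': "integrable \<rho> p"
        by (simp only: complex_of_real_integrable_eq)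
      have "\<bar>(\<integral>x. f x \<partial>\<rho>) - (\<integral>x. p x \<partial>\<rho>)\<bar> = \<bar>\<integral>x. f x - p x \<partial>\<rho>\<bar>"
        using f p' by simp
      also have "\<dots> \<le> (\<integral>x. \<bar>f x - p x\<bar> \<partial>\<rho>)"
        by (rule integral_abs_bound)
      also have "\<dots> \<le> (\<integral>x. e / 3 \<partial>\<rho>)"
        using f p' p(2) by (intro integral_mono) (auto simp: sp less_imp_le)
      also have "\<dots> = e / 3" by (simp add: prob_space)
      finally show ?thesis .
    qed
    have "(\<lambda>n. \<integral>x. complex_of_real (p x) \<partial>\<mu> n) \<longlonglongrightarrow> (\<integral>x. complex_of_real (p x) \<partial>\<nu>)"
    proof (rule tendsto_integral_trig_poly[OF _ _ _ \<nu>(2) lim])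
      show "trig_poly (\<lambda>x. complex_of_real (p x))"
        by (rule trig_poly_real_polynomial_function[OF p(1)])
      show "\<forall>\<^sub>F n in sequentially. finite_measure (\<mu> n) \<and> sets (\<mu> n) = sets torus_borel"
        using \<mu> by eventually_elim (auto intro: prob_space.finite_measure)
      show "finite_measure \<nu>"
        using \<nu>(1) by (rule prob_space.finite_measure)
    qed
    then have "(\<lambda>n. \<integral>x. p x \<partial>\<mu> n) \<longlonglongrightarrow> (\<integral>x. p x \<partial>\<nu>)"
      by (simp add: tendsto_of_real_iff)
    from tendstoD[OF this, of "e / 3"]
    have "\<forall>\<^sub>F n in sequentially. dist (\<integral>x. p x \<partial>\<mu> n) (\<integral>x. p x \<partial>\<nu>) < e / 3"
      using \<open>e > 0\<close> by simp
    with \<mu> show "\<forall>\<^sub>F n in sequentially. dist (\<integral>x. f x \<partial>\<mu> n) (\<integral>x. f x \<partial>\<nu>) < e"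
    proof eventually_elim
      case (elim n)
      have "\<bar>(\<integral>x. f x \<partial>\<mu> n) - (\<integral>x. p x \<partial>\<mu> n)\<bar> \<le> e / 3" using elim by (intro near) auto
      with near[OF \<nu>] elim show ?case unfolding dist_real_def by linarith
    qed
  qed
qed

text \<open>Applied to a constant sequence, \<open>torus_weak_convI\<close> shows that integrals of
  continuous functions agree. These determine the masses of closed sets, and closed sets generate
  the Borel sets.\<close>

lemma torus_measure_eqI:
  assumes \<mu>: "prob_space \<mu>" "sets \<mu> = sets torus_borel"
    and \<nu>: "prob_space \<nu>" "sets \<nu> = sets torus_borel"
    and eq: "\<And>l::int. (\<integral>z. z powi l \<partial>\<mu>) = (\<integral>z. z powi l \<partial>\<nu>)"
  shows "\<mu> = \<nu>"
proof -
  have wc: "torus_weak_conv (\<lambda>_. \<mu>) \<nu>"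
    by (rule torus_weak_convI) (use assms in auto)
  have int_eq: "(\<integral>z. f z \<partial>\<mu>) = (\<integral>z. f z \<partial>\<nu>)" if "continuous_on torus f" for f :: "complex \<Rightarrow> real"
  proof -
    have "bounded (f ` torus)"
      using compact_continuous_image[OF that compact_torus] by (rule compact_imp_bounded)
    then have "(\<lambda>_::nat. \<integral>z. f z \<partial>\<mu>) \<longlonglongrightarrow> (\<integral>z. f z \<partial>\<nu>)"
      using wc that by (auto simp: torus_weak_conv_def)
    then show ?thesis by (simp add: LIMSEQ_const_iff)
  qed
  \<comment> \<open>The inclusion of the torus into the plane; after pushing forward along it, the
    closed subsets of the plane serve as generator.\<close>
  have emb: "id \<in> measurable \<rho> borel" if "sets \<rho> = sets torus_borel" for \<rho>
    using borel_measurable_continuous_torus[OF continuous_on_id]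
      measurable_cong_sets[OF that refl] by (auto simp: id_def)
  \<comment> \<open>Continuous functions decreasing to the indicator of the closed set
    \<open>F\<close>. The case \<open>F = {}\<close> is kept apart because
    \<open>infdist z {}\<close> is \<open>0\<close> by convention, which would make the limit
    \<open>1\<close>.\<close>
  have lim: "(\<lambda>n. \<integral>z. max 0 (1 - real n * infdist z F) \<partial>\<rho>) \<longlonglongrightarrow> measure (distr \<rho> borel id) F"
    if "prob_space \<rho>" "sets \<rho> = sets torus_borel" "closed F" "F \<noteq> {}" for \<rho> F
  proof -
    interpret prob_space \<rho> by fact
    have F: "F \<in> sets borel" using that by auto
    have [measurable]: "(\<lambda>x. x) \<in> measurable \<rho> borel"
      using emb[OF that(2)] by (simp add: id_def)
    have cont: "continuous_on UNIV (\<lambda>z. infdist z F)" by (intro continuous_intros)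
    have [measurable]: "(\<lambda>z. infdist z F) \<in> borel_measurable \<rho>"
      by (rule borel_measurable_continuous_on[OF cont]) simp
    have [measurable]: "F \<in> sets borel" by fact
    have "(\<lambda>n. \<integral>z. max 0 (1 - real n * infdist z F) \<partial>\<rho>) \<longlonglongrightarrow> (\<integral>z. indicat_real F z \<partial>\<rho>)"
    proof (rule integral_dominated_convergence[where w="\<lambda>_. 1"])
      show "AE x in \<rho>. (\<lambda>n. max 0 (1 - real n * infdist x F)) \<longlonglongrightarrow> indicat_real F x"
      proof (rule AE_I2)
        fix x
        show "(\<lambda>n. max 0 (1 - real n * infdist x F)) \<longlonglongrightarrow> indicat_real F x"
        proof (cases "x \<in> F")
          case False
          then have d: "infdist x F > 0"
            using that by (simp add: infdist_pos_not_in_closed)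
          \<comment> \<open>From \<open>N\<close> on the product \<open>real n * infdist x F\<close>
            exceeds \<open>1\<close>, so the sequence vanishes.\<close>
          obtain N :: nat where N: "1 / infdist x F < real N"
            using reals_Archimedean2 by blast
          have "\<forall>\<^sub>F n in sequentially. max 0 (1 - real n * infdist x F) = 0"
            using eventually_ge_at_top[of N]
          proof eventually_elim
            case (elim n)
            have "1 < real N * infdist x F" using N d by (simp add: field_simps)
            also have "\<dots> \<le> real n * infdist x F" using elim d by simp
            finally show ?case by simp
          qed
          then show ?thesis using False by (simp add: tendsto_eventually)
        qed simp
      qed
      show "AE x in \<rho>. norm (max 0 (1 - real n * infdist x F)) \<le> 1" for n
        by (intro AE_I2) (auto simp: infdist_nonneg)
      have "(\<lambda>x. indicat_real F x) \<in> borel_measurable \<rho>" by measurable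
      then show "indicat_real F \<in> borel_measurable \<rho>" .
    qed auto
    also have "(\<integral>z. indicat_real F z \<partial>\<rho>) = measure (distr \<rho> borel id) F"
      using integral_distr[OF emb[OF that(2)], of "indicat_real F"] F by simp
    finally show ?thesis .
  qed
  have "distr \<mu> borel id = distr \<nu> borel id"
  proof (rule measure_eqI_generator_eq[where E="Collect closed" and \<Omega>=UNIV and A="\<lambda>_. UNIV"])
    interpret \<mu>: prob_space "distr \<mu> borel id" by (rule prob_space.prob_space_distr[OF \<mu>(1) emb[OF \<mu>(2)]])
    interpret \<nu>: prob_space "distr \<nu> borel id" by (rule prob_space.prob_space_distr[OF \<nu>(1) emb[OF \<nu>(2)]])
    show "Int_stable (Collect closed :: complex set set)" by (auto simp: Int_stable_def)
    show "emeasure (distr \<mu> borel id) F = emeasure (distr \<nu> borel id) F" if "F \<in> Collect closed" for F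
    proof (cases "F = {}")
      case False
      have "(\<integral>z. max 0 (1 - real n * infdist z F) \<partial>\<mu>) = (\<integral>z. max 0 (1 - real n * infdist z F) \<partial>\<nu>)" for n
        by (intro int_eq continuous_intros)
      with lim[OF \<mu>, of F] lim[OF \<nu>, of F] False that
      have "measure (distr \<mu> borel id) F = measure (distr \<nu> borel id) F"
        by (auto intro: LIMSEQ_unique)
      then show ?thesis by (simp add: \<mu>.emeasure_eq_measure \<nu>.emeasure_eq_measure)
    qed simp
    show "emeasure (distr \<mu> borel id) UNIV \<noteq> \<infinity>" by simp
  qed (auto simp: borel_eq_closed)
  \<comment> \<open>Every set of \<open>torus_borel\<close> has the form
    \<open>torus \<inter> B\<close>, so its mass is that of \<open>B\<close> under the
    pushforward.\<close>
  moreover have "emeasure \<rho> (torus \<inter> B) = emeasure (distr \<rho> borel id) B"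
    if "sets \<rho> = sets torus_borel" "B \<in> sets borel" for \<rho> B
  proof -
    have "space \<rho> = torus"
      by (rule space_eq_torus) (fact that)+
    then show ?thesis using emb[OF that(1)] that(2) by (simp add: emeasure_distr Int_commute)
  qed
  ultimately show ?thesis
    using \<mu>(2) \<nu>(2) by (intro measure_eqI) (auto simp: sets_torus_borel)
qed

section \<open>Products on the torus, the Gaussian measure, and convolution with a point
  mass\<close>

lemma measurable_prod_torus:
  assumes meas: "\<And>k. k \<in> I \<Longrightarrow> X k \<in> measurable M torus_borel"
  shows "(\<lambda>\<omega>. \<Prod>k\<in>I. X k \<omega>) \<in> measurable M torus_borel"
proof (rule measurable_torus_borelI)
  show "(\<lambda>\<omega>. \<Prod>k\<in>I. X k \<omega>) \<in> borel_measurable M"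
    using meas by (intro borel_measurable_prod borel_measurable_torus)
  show "(\<Prod>k\<in>I. X k \<omega>) \<in> torus" if "\<omega> \<in> space M" for \<omega>
    using measurable_space[OF meas that] by (simp add: torus_def flip: prod_norm)
qed

text \<open>Justifies the definite description: the wrapped normal law, the image of the standard
  normal under \<open>\<lambda>x. cis (sqrt b * x)\<close>, has the required coefficients, and
  \<open>torus_measure_eqI\<close> gives uniqueness.\<close>

lemma torus_gauss:
  assumes "b \<ge> 0"
  shows "prob_space (torus_gauss b)" "sets (torus_gauss b) = sets torus_borel"
    "(\<integral>y. y powi l \<partial>torus_gauss b) = complex_of_real (exp (- b * (of_int l)\<^sup>2 / 2))"
proof -
  let ?P = "\<lambda>\<gamma>. prob_space \<gamma> \<and> sets \<gamma> = sets torus_borel \<and>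
    (\<forall>l :: int. (\<integral>y. y powi l \<partial>\<gamma>) = complex_of_real (exp (- b * (of_int l)\<^sup>2 / 2)))"
  define \<gamma> where "\<gamma> = distr std_normal_distribution torus_borel (\<lambda>x. cis (sqrt b * x))"
  interpret N: real_distribution std_normal_distribution by (rule real_dist_normal_dist)
  have cis: "(\<lambda>x. cis (sqrt b * x)) \<in> measurable std_normal_distribution torus_borel"
  proof (rule measurable_torus_borelI)
    have "continuous_on UNIV (\<lambda>x. cis (sqrt b * x))"
      by (intro continuous_intros)
    then show "(\<lambda>x. cis (sqrt b * x)) \<in> borel_measurable std_normal_distribution"
      using borel_measurable_continuous_onI by simp
  qed simp
  have "(\<integral>y. y powi l \<partial>\<gamma>) = complex_of_real (exp (- b * (of_int l)\<^sup>2 / 2))" for l :: int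
  proof -
    have "(\<integral>y. y powi l \<partial>\<gamma>) = (\<integral>x. cis (sqrt b * x) powi l \<partial>std_normal_distribution)"
      unfolding \<gamma>_def
      by (intro integral_distr cis borel_measurable_continuous_torus continuous_intros)
         (auto simp: torus_not_zero)
    \<comment> \<open>The power multiplies the angle by \<open>l\<close>, so the coefficient is a
      value of the normal characteristic function.\<close>
    also have "\<dots> = char std_normal_distribution (of_int l * sqrt b)"
      unfolding char_def cis_power_int by (simp add: cis_conv_exp mult.assoc)
    also have "\<dots> = complex_of_real (exp (- b * (of_int l)\<^sup>2 / 2))"
      using assms by (simp add: char_std_normal_distribution power_mult_distrib mult.commute)
    finally show ?thesis .
  qed
  moreover have "prob_space \<gamma>" unfolding \<gamma>_def using cis by (rule N.prob_space_distr)
  ultimately have "?P \<gamma>" by (simp add: \<gamma>_def)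
  moreover have "\<gamma>' = \<gamma>" if "?P \<gamma>'" for \<gamma>'
    using that \<open>?P \<gamma>\<close> by (intro torus_measure_eqI) auto
  ultimately have "?P (torus_gauss b)"
    unfolding torus_gauss_def by (rule theI)
  then show "prob_space (torus_gauss b)" "sets (torus_gauss b) = sets torus_borel"
    "(\<integral>y. y powi l \<partial>torus_gauss b) = complex_of_real (exp (- b * (of_int l)\<^sup>2 / 2))"
    by auto
qed

text \<open>Convolution with a point mass is rotation by \<open>a\<close>. By Fubini and
  \<open>power_int_mult_distrib\<close> the coefficients multiply, and that of the point mass is
  \<open>a powi l\<close>.\<close>

lemma torus_convolution_return:
  assumes "a \<in> torus" "prob_space \<nu>" "sets \<nu> = sets torus_borel"
  shows "prob_space (torus_convolution (return torus_borel a) \<nu>)"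
    "sets (torus_convolution (return torus_borel a) \<nu>) = sets torus_borel"
    "(\<integral>z. z powi l \<partial>torus_convolution (return torus_borel a) \<nu>) = a powi l * (\<integral>z. z powi l \<partial>\<nu>)"
proof -
  interpret \<nu>: prob_space \<nu> by fact
  interpret R: prob_space "return torus_borel a"
    by (rule prob_space_return) (simp add: assms)
  interpret P: pair_prob_space "return torus_borel a" \<nu> ..
  have sp: "space \<nu> = torus" using assms(3) by (rule space_eq_torus)
  have id: "(\<lambda>z. z) \<in> borel_measurable torus_borel"
    by (intro borel_measurable_continuous_torus continuous_intros)
  have "(\<lambda>z. z) \<in> borel_measurable (return torus_borel a)" "(\<lambda>z. z) \<in> borel_measurable \<nu>"
    using id by (simp_all cong: measurable_cong_sets add: assms(3))
  from measurable_compose[OF measurable_fst this(1)] measurable_compose[OF measurable_snd this(2)]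
  have [measurable]: "fst \<in> borel_measurable (return torus_borel a \<Otimes>\<^sub>M \<nu>)"
    "snd \<in> borel_measurable (return torus_borel a \<Otimes>\<^sub>M \<nu>)"
    by auto
  have mult: "(\<lambda>(x, y). x * y) \<in> measurable (return torus_borel a \<Otimes>\<^sub>M \<nu>) torus_borel"
    by (rule measurable_torus_borelI)
       (auto simp: split_beta' space_pair_measure sp torus_def norm_mult)
  show "prob_space (torus_convolution (return torus_borel a) \<nu>)"
    unfolding torus_convolution_def using mult by (rule P.prob_space_distr)
  show "sets (torus_convolution (return torus_borel a) \<nu>) = sets torus_borel"
    by (simp add: torus_convolution_def)
  have pow: "(\<lambda>z. z powi l) \<in> borel_measurable torus_borel"
    by (intro borel_measurable_continuous_torus continuous_intros) (auto simp: torus_not_zero)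
  have "(\<integral>z. z powi l \<partial>torus_convolution (return torus_borel a) \<nu>) =
      (\<integral>p. (fst p * snd p) powi l \<partial>(return torus_borel a \<Otimes>\<^sub>M \<nu>))"
    unfolding torus_convolution_def
    by (subst integral_distr[OF mult pow]) (simp add: split_beta')
  also have "\<dots> = (\<integral>x. \<integral>y. (x * y) powi l \<partial>\<nu> \<partial>return torus_borel a)"
  proof -
    have "integrable (return torus_borel a \<Otimes>\<^sub>M \<nu>) (\<lambda>p. (fst p * snd p) powi l)"
    proof (rule P.integrable_const_bound[where B=1])
      show "AE p in return torus_borel a \<Otimes>\<^sub>M \<nu>. norm ((fst p * snd p) powi l) \<le> 1"
        by (intro AE_I2) (auto simp: space_pair_measure sp norm_torus norm_mult norm_power_int)
      show "(\<lambda>p. (fst p * snd p) powi l) \<in> borel_measurable (return torus_borel a \<Otimes>\<^sub>M \<nu>)"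
        using measurable_compose[OF mult pow] by (simp add: split_beta')
    qed
    from P.integral_fst'[OF this] show ?thesis by simp
  qed
  also have "\<dots> = (\<integral>x. x powi l * (\<integral>y. y powi l \<partial>\<nu>) \<partial>return torus_borel a)"
    by (simp add: power_int_mult_distrib)
  also have "\<dots> = a powi l * (\<integral>z. z powi l \<partial>\<nu>)"
    using pow assms(1) by (subst integral_return) auto
  finally show "(\<integral>z. z powi l \<partial>torus_convolution (return torus_borel a) \<nu>) =
    a powi l * (\<integral>z. z powi l \<partial>\<nu>)" .
qed

section \<open>The argument on the torus and its measurability\<close>

text \<open>\<open>Arg\<close> is a valid angle in \<open>(-pi, pi]\<close>. Moving the value
  \<open>pi\<close> to \<open>- pi\<close> gives an angle in the required half-open interval, which
  \<open>torus_arg_cis\<close> identifies as \<open>torus_arg z\<close>.\<close>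

lemma torus_arg:
  assumes "z \<in> torus"
  shows "- pi \<le> torus_arg z" "torus_arg z < pi" "cis (torus_arg z) = z"
proof -
  define x where "x = (if Arg z = pi then - pi else Arg z)"
  have "cis (Arg z) = z"
    using assms by (simp add: cis_Arg torus_not_zero norm_torus sgn_div_norm)
  moreover have "cis (- pi) = cis pi" by (simp add: complex_eq_iff)
  ultimately have "cis x = z" "- pi \<le> x" "x < pi"
    using Arg_bounded[of z] by (auto simp: x_def)
  with torus_arg_cis[of x] show "- pi \<le> torus_arg z" "torus_arg z < pi" "cis (torus_arg z) = z"
    by auto
qed

text \<open>This formula makes the Borel measurability of \<^const>\<open>torus_arg\<close> evident.\<close>

lemma torus_arg_conv_arccos:
  assumes "z \<in> torus"
  shows "torus_arg z = (if Im z > 0 then arccos (Re z) else - arccos (Re z))"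
proof -
  define x where "x = torus_arg z"
  have x: "- pi \<le> x" "x < pi" and z: "z = cis x"
    using torus_arg[OF assms] by (auto simp: x_def)
  show ?thesis
  proof (cases "x > 0")
    case True
    then show ?thesis
      using x arccos_cos[of x] sin_gt_zero[of x] by (simp add: z torus_arg_cis)
  next
    \<comment> \<open>The angles \<open>0\<close> and \<open>- pi\<close> of the two real points
      both belong to this branch, which fits the strict test \<open>Im z > 0\<close>.\<close>
    case False
    then have "sin x \<le> 0" using x sin_ge_zero[of "- x"] by simp
    then show ?thesis
      using False x arccos_cos2[of x] by (simp add: z torus_arg_cis)
  qed
qed

lemma borel_measurable_torus_arg: "torus_arg \<in> borel_measurable torus_borel"
proof -
  have id [measurable]: "(\<lambda>z. z) \<in> borel_measurable torus_borel"
    by (intro borel_measurable_continuous_torus continuous_intros)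
  have "continuous_on torus (\<lambda>z. arccos (Re z))"
  proof (intro continuous_intros ballI)
    fix z assume "z \<in> torus"
    then show "- 1 \<le> Re z \<and> Re z \<le> 1"
      using abs_Re_le_cmod[of z] by (simp add: torus_def abs_le_iff)
  qed
  note [measurable] = borel_measurable_continuous_torus[OF this]
  have [measurable]: "Im \<in> borel_measurable torus_borel"
    by (intro borel_measurable_continuous_torus continuous_intros)
  have "(\<lambda>z. if Im z > 0 then arccos (Re z) else - arccos (Re z)) \<in> borel_measurable torus_borel"
    by measurable
  then show ?thesis
    by (rule measurable_cong[THEN iffD2, rotated]) (simp add: torus_arg_conv_arccos)
qed

section \<open>Quantitative estimates for exponentials and moments\<close>

text \<open>For the upper bound, the quadratic Taylor polynomials at \<open>s\<close> and
  \<open>- s\<close> multiply to \<open>1 + s ^ 4 / 4\<close>, which is at least \<open>1\<close>,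
  and \<open>exp s\<close> dominates its own polynomial; hence the polynomial at \<open>- s\<close>
  dominates \<open>1 / exp s\<close>.\<close>

lemma abs_exp_minus_le:
  fixes s :: real
  assumes "s \<ge> 0"
  shows "\<bar>exp (- s) - (1 - s)\<bar> \<le> s\<^sup>2 / 2"
proof -
  have lower: "1 - s \<le> exp (- s)" using exp_ge_add_one_self[of "- s"] by simp
  have "1 \<le> 1 + s ^ 4 / 4" by simp
  also have "\<dots> = (1 - s + s\<^sup>2 / 2) * (1 + s + s\<^sup>2 / 2)"
    by (simp add: algebra_simps power2_eq_square power4_eq_xxxx)
  also have "\<dots> \<le> (1 - s + s\<^sup>2 / 2) * exp s"
  proof (rule mult_left_mono)
    show "1 + s + s\<^sup>2 / 2 \<le> exp s" using assms by (rule exp_lower_Taylor_quadratic)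
    show "0 \<le> 1 - s + s\<^sup>2 / 2"
      using zero_le_power2[of "1 - s"] by (simp add: power2_eq_square algebra_simps)
  qed
  finally have "exp (- s) \<le> 1 - s + s\<^sup>2 / 2"
    by (simp add: exp_minus field_simps)
  with lower show ?thesis by simp
qed

context prob_space
begin

text \<open>Both terms are compared with \<open>1 - t\<^sup>2 * \<sigma> / 2\<close>, where
  \<open>\<sigma>\<close> is the second moment. The Taylor remainder of \<open>cis\<close> gives the
  constant \<open>\<bar>t\<bar> ^ 3 / 6\<close>. That of the real exponential gives
  \<open>t ^ 4 / 8 * \<sigma>\<^sup>2\<close>, and \<open>\<sigma>\<^sup>2\<close> is bounded
  through the fourth moment by \<open>C\<close> times the third absolute moment.\<close>

lemma char_gauss_approx:
  assumes [measurable]: "Z \<in> borel_measurable M"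
    and bound: "\<And>\<omega>. \<omega> \<in> space M \<Longrightarrow> \<bar>Z \<omega>\<bar> \<le> C"
    and mean: "expectation Z = 0"
  shows "cmod (expectation (\<lambda>\<omega>. cis (t * Z \<omega>)) -
      complex_of_real (exp (- (t\<^sup>2 * expectation (\<lambda>\<omega>. (Z \<omega>)\<^sup>2)) / 2)))
    \<le> (\<bar>t\<bar> ^ 3 / 6 + C * t ^ 4 / 8) * expectation (\<lambda>\<omega>. \<bar>Z \<omega>\<bar> ^ 3)"
proof -
  have int: "integrable M (\<lambda>\<omega>. \<bar>Z \<omega>\<bar> ^ k)" for k
    using bound by (intro integrable_const_bound[where B="C ^ k"] AE_I2) (auto intro: power_mono)
  have int': "integrable M (\<lambda>\<omega>. Z \<omega> ^ k)" for k
    by (rule Bochner_Integration.integrable_bound[OF int[of k]]) (auto simp: power_abs)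
  have intZ: "integrable M Z" using int'[of 1] by simp
  have intcis: "integrable M (\<lambda>\<omega>. cis (t * Z \<omega>))"
  proof (rule integrable_const_bound[where B=1])
    have "continuous_on UNIV (\<lambda>x. cis (t * x))" by (intro continuous_intros)
    then show "(\<lambda>\<omega>. cis (t * Z \<omega>)) \<in> borel_measurable M"
      using assms(1) by (rule borel_measurable_continuous_on)
  qed simp
  define \<sigma> where "\<sigma> = expectation (\<lambda>\<omega>. (Z \<omega>)\<^sup>2)"
  \<comment> \<open>The second-order Taylor polynomial of \<open>cis (t * x)\<close>; the linear
    term of \<open>q (Z \<omega>)\<close> has mean zero because \<open>Z\<close> is centred.\<close>
  define q where "q = (\<lambda>x::real. 1 + \<i> * complex_of_real (t * x) - complex_of_real (t\<^sup>2 * x\<^sup>2 / 2))"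
  have lin: "integrable M (\<lambda>\<omega>. \<i> * complex_of_real (t * Z \<omega>))"
    and quad: "integrable M (\<lambda>\<omega>. complex_of_real (t\<^sup>2 * (Z \<omega>)\<^sup>2 / 2))"
    using intZ int'[of 2] by (intro integrable_mult_right integrable_of_real; simp)+
  then have intq: "integrable M (\<lambda>\<omega>. q (Z \<omega>))"
    unfolding q_def by (intro Bochner_Integration.integrable_diff Bochner_Integration.integrable_add) auto
  have expq: "expectation (\<lambda>\<omega>. q (Z \<omega>)) = complex_of_real (1 - t\<^sup>2 * \<sigma> / 2)"
    unfolding q_def using lin quad mean
    by (simp add: \<sigma>_def prob_space del: of_real_mult of_real_divide of_real_power)
  have "cmod (expectation (\<lambda>\<omega>. cis (t * Z \<omega>)) - complex_of_real (1 - t\<^sup>2 * \<sigma> / 2))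
      = cmod (expectation (\<lambda>\<omega>. cis (t * Z \<omega>) - q (Z \<omega>)))"
    by (simp only: Bochner_Integration.integral_diff[OF intcis intq] expq)
  also have "\<dots> \<le> expectation (\<lambda>\<omega>. cmod (cis (t * Z \<omega>) - q (Z \<omega>)))"
    by (rule integral_norm_bound)
  also have "\<dots> \<le> expectation (\<lambda>\<omega>. \<bar>t\<bar> ^ 3 / 6 * \<bar>Z \<omega>\<bar> ^ 3)"
  proof (rule integral_mono)
    fix \<omega>
    have "cmod (cis y - (1 + \<i> * complex_of_real y - complex_of_real (y\<^sup>2 / 2))) \<le> \<bar>y\<bar> ^ 3 / 6" for y
      using iexp_approx1[of y 2]
      by (simp add: cis_conv_exp numeral_eq_Suc algebra_simps)
    from this[of "t * Z \<omega>"]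
    show "cmod (cis (t * Z \<omega>) - q (Z \<omega>)) \<le> \<bar>t\<bar> ^ 3 / 6 * \<bar>Z \<omega>\<bar> ^ 3"
      by (simp add: q_def power_mult_distrib abs_mult)
  qed (use intcis intq int in auto)
  finally have 1: "cmod (expectation (\<lambda>\<omega>. cis (t * Z \<omega>)) - complex_of_real (1 - t\<^sup>2 * \<sigma> / 2))
      \<le> \<bar>t\<bar> ^ 3 / 6 * expectation (\<lambda>\<omega>. \<bar>Z \<omega>\<bar> ^ 3)"
    by simp
  \<comment> \<open>Nonnegativity of the variance of the square of \<open>Z\<close> bounds
    \<open>\<sigma>\<^sup>2\<close> by the fourth moment, in which one factor
    \<open>\<bar>Z \<omega>\<bar>\<close> is then replaced by \<open>C\<close>.\<close>
  have "0 \<le> expectation (\<lambda>\<omega>. ((Z \<omega>)\<^sup>2 - \<sigma>)\<^sup>2)" by simp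
  also have "\<dots> = expectation (\<lambda>\<omega>. Z \<omega> ^ 4 - 2 * \<sigma> * (Z \<omega>)\<^sup>2 + \<sigma>\<^sup>2)"
    by (intro Bochner_Integration.integral_cong)
       (simp_all add: power2_eq_square power4_eq_xxxx algebra_simps)
  also have "\<dots> = expectation (\<lambda>\<omega>. Z \<omega> ^ 4) - \<sigma>\<^sup>2"
    using int'[of 2] int'[of 4] by (simp add: prob_space power2_eq_square[of \<sigma>] flip: \<sigma>_def)
  finally have "\<sigma>\<^sup>2 \<le> expectation (\<lambda>\<omega>. Z \<omega> ^ 4)" by simp
  also have "\<dots> \<le> expectation (\<lambda>\<omega>. C * \<bar>Z \<omega>\<bar> ^ 3)"
  proof (rule integral_mono)
    fix \<omega> assume "\<omega> \<in> space M"
    have "Z \<omega> ^ 4 = \<bar>Z \<omega>\<bar> * \<bar>Z \<omega>\<bar> ^ 3"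
      by (simp add: power_abs flip: power_Suc)
    also have "\<dots> \<le> C * \<bar>Z \<omega>\<bar> ^ 3"
      using bound[OF \<open>\<omega> \<in> space M\<close>] by (intro mult_right_mono) auto
    finally show "Z \<omega> ^ 4 \<le> C * \<bar>Z \<omega>\<bar> ^ 3" .
  qed (use int int' in auto)
  finally have \<sigma>2: "\<sigma>\<^sup>2 \<le> C * expectation (\<lambda>\<omega>. \<bar>Z \<omega>\<bar> ^ 3)" by simp
  have "\<bar>exp (- (t\<^sup>2 * \<sigma> / 2)) - (1 - t\<^sup>2 * \<sigma> / 2)\<bar> \<le> (t\<^sup>2 * \<sigma> / 2)\<^sup>2 / 2"
    by (rule abs_exp_minus_le) (simp add: \<sigma>_def)
  also have "\<dots> = t ^ 4 / 8 * \<sigma>\<^sup>2"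
    by (simp add: power_mult_distrib power_divide)
  also have "\<dots> \<le> t ^ 4 / 8 * (C * expectation (\<lambda>\<omega>. \<bar>Z \<omega>\<bar> ^ 3))"
    by (intro mult_left_mono \<sigma>2) simp
  finally have 2: "cmod (complex_of_real (1 - t\<^sup>2 * \<sigma> / 2) - complex_of_real (exp (- (t\<^sup>2 * \<sigma> / 2))))
      \<le> t ^ 4 / 8 * (C * expectation (\<lambda>\<omega>. \<bar>Z \<omega>\<bar> ^ 3))"
    by (simp only: norm_of_real abs_minus_commute flip: of_real_diff)
  show ?thesis
    using norm_triangle_mono[OF 1 2] by (simp add: algebra_simps flip: \<sigma>_def)
qed

text \<open>Off the event \<open>\<bar>Y \<omega>\<bar> > \<delta>\<close> one factor of the cube is
  at most \<open>3 * \<delta>\<close>, since the last hypothesis forces the mean to be at most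
  \<open>2 * \<delta>\<close> in modulus. On the event the deviation is bounded by
  \<open>2 * C\<close>.\<close>

lemma third_central_moment_le:
  assumes [measurable]: "Y \<in> borel_measurable M"
    and bound: "\<And>\<omega>. \<omega> \<in> space M \<Longrightarrow> \<bar>Y \<omega>\<bar> \<le> C"
    and "\<delta> \<ge> 0" "C * prob {\<omega>\<in>space M. \<bar>Y \<omega>\<bar> > \<delta>} \<le> \<delta>"
  shows "expectation (\<lambda>\<omega>. \<bar>Y \<omega> - expectation Y\<bar> ^ 3)
    \<le> 3 * \<delta> * variance Y + (2 * C) ^ 3 * prob {\<omega>\<in>space M. \<bar>Y \<omega>\<bar> > \<delta>}"
proof -
  define m where "m = expectation Y"
  define A where "A = {\<omega>\<in>space M. \<bar>Y \<omega>\<bar> > \<delta>}"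
  have [measurable]: "A \<in> events" by (simp add: A_def)
  \<comment> \<open>A probability space is nonempty, so the bound at one point gives
    \<open>C \<ge> 0\<close>.\<close>
  obtain \<omega>0 where "\<omega>0 \<in> space M" using not_empty by blast
  with bound[of \<omega>0] have C: "C \<ge> 0" by linarith
  have intY: "integrable M Y"
    using bound by (intro integrable_const_bound[where B=C] AE_I2) auto
  have iA: "integrable M (indicat_real A)" by (simp add: integrable_indicator_iff emeasure_eq_measure)
  have EA: "expectation (indicat_real A) = prob A" by simp
  have le: "expectation (\<lambda>\<omega>. \<bar>Y \<omega>\<bar>) \<le> expectation (\<lambda>\<omega>. \<delta> + C * indicat_real A \<omega>)"
  proof (rule integral_mono)
    show "\<bar>Y \<omega>\<bar> \<le> \<delta> + C * indicat_real A \<omega>" if "\<omega> \<in> space M" for \<omega>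
      using bound[OF that] that C assms(3) by (auto simp: A_def indicator_def)
  qed (use intY iA in auto)
  have "\<bar>m\<bar> \<le> expectation (\<lambda>\<omega>. \<bar>Y \<omega>\<bar>)" unfolding m_def by (rule integral_abs_bound)
  also note le
  also have "expectation (\<lambda>\<omega>. \<delta> + C * indicat_real A \<omega>) = \<delta> + C * prob A"
    using iA by (simp add: prob_space)
  finally have m2: "\<bar>m\<bar> \<le> 2 * \<delta>" using assms(4) by (simp flip: A_def)
  \<comment> \<open>A second bound on the mean, independent of \<open>\<delta>\<close>, which yields
    the deviation bound \<open>2 * C\<close> everywhere.\<close>
  have mC: "\<bar>m\<bar> \<le> C"
  proof -
    have "\<bar>m\<bar> \<le> expectation (\<lambda>\<omega>. \<bar>Y \<omega>\<bar>)" unfolding m_def by (rule integral_abs_bound)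
    also have "\<dots> \<le> expectation (\<lambda>\<omega>. C)" using bound intY by (intro integral_mono) auto
    finally show ?thesis by (simp add: prob_space)
  qed
  have diff: "\<bar>Y \<omega> - m\<bar> \<le> 2 * C" if "\<omega> \<in> space M" for \<omega>
    using bound[OF that] mC by linarith
  have int: "integrable M (\<lambda>\<omega>. \<bar>Y \<omega> - m\<bar> ^ k)" for k
    using diff by (intro integrable_const_bound[where B="(2 * C) ^ k"] AE_I2)
       (simp_all only: abs_abs power_abs real_norm_def abs_ge_zero power_mono, simp)
  have int2: "integrable M (\<lambda>\<omega>. (Y \<omega> - m)\<^sup>2)" using int[of 2] by simp
  have "expectation (\<lambda>\<omega>. \<bar>Y \<omega> - m\<bar> ^ 3)
      \<le> expectation (\<lambda>\<omega>. 3 * \<delta> * (Y \<omega> - m)\<^sup>2 + (2 * C) ^ 3 * indicat_real A \<omega>)"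
  proof (rule integral_mono)
    fix \<omega> assume \<omega>: "\<omega> \<in> space M"
    show "\<bar>Y \<omega> - m\<bar> ^ 3 \<le> 3 * \<delta> * (Y \<omega> - m)\<^sup>2 + (2 * C) ^ 3 * indicat_real A \<omega>"
    proof (cases "\<omega> \<in> A")
      case True
      have "\<bar>Y \<omega> - m\<bar> ^ 3 \<le> (2 * C) ^ 3" using diff[OF \<omega>] by (intro power_mono) auto
      then show ?thesis using True assms(3) by (simp add: add_increasing)
    next
      case False
      then have "\<bar>Y \<omega> - m\<bar> \<le> 3 * \<delta>" using \<omega> m2 by (auto simp: A_def)
      then have "\<bar>Y \<omega> - m\<bar> * \<bar>Y \<omega> - m\<bar>\<^sup>2 \<le> 3 * \<delta> * \<bar>Y \<omega> - m\<bar>\<^sup>2"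
        by (rule mult_right_mono) simp
      then show ?thesis using False by (simp add: power3_eq_cube power2_eq_square mult.assoc)
    qed
  qed (use int int2 iA in auto)
  also have "\<dots> = 3 * \<delta> * expectation (\<lambda>\<omega>. (Y \<omega> - m)\<^sup>2) + (2 * C) ^ 3 * prob A"
    using int2 iA by simp
  finally show ?thesis by (simp add: m_def A_def)
qed

section \<open>Fourier coefficients of a product of independent elements\<close>

text \<open>The rotations by the mean arguments are common to both terms and drop out of the norm.
  For products of numbers of modulus at most one, the difference is at most the sum of the
  differences of the factors; each is bounded by \<open>char_gauss_approx\<close> with
  \<open>C = 2 * pi\<close>, as both an argument and its mean lie within \<open>pi\<close> of
  zero.\<close>

lemma fourier_prod_approx:
  fixes X :: "'i \<Rightarrow> 'a \<Rightarrow> complex"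
  assumes "finite I"
    and meas: "\<And>k. k \<in> I \<Longrightarrow> X k \<in> measurable M torus_borel"
    and indep: "indep_vars (\<lambda>_. torus_borel) X I"
  defines "Y \<equiv> \<lambda>k \<omega>. torus_arg (X k \<omega>)"
  shows "cmod ((\<integral>z. z powi l \<partial>distr M torus_borel (\<lambda>\<omega>. \<Prod>k\<in>I. X k \<omega>)) -
      exp (\<i> * complex_of_real (\<Sum>k\<in>I. expectation (Y k))) powi l *
      complex_of_real (exp (- ((of_int l)\<^sup>2 * (\<Sum>k\<in>I. variance (Y k))) / 2)))
    \<le> (\<bar>of_int l\<bar> ^ 3 / 6 + 2 * pi * (of_int l) ^ 4 / 8) *
      (\<Sum>k\<in>I. expectation (\<lambda>\<omega>. \<bar>Y k \<omega> - expectation (Y k)\<bar> ^ 3))"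
proof -
  define m where "m k = expectation (Y k)" for k
  define L where "L = real_of_int l"
  have X_torus: "X k \<omega> \<in> torus" if "k \<in> I" "\<omega> \<in> space M" for k \<omega>
    using measurable_space[OF meas[OF that(1)] that(2)] by simp
  have Y_bound: "\<bar>Y k \<omega>\<bar> \<le> pi" if "k \<in> I" "\<omega> \<in> space M" for k \<omega>
    using torus_arg[OF X_torus[OF that]] by (auto simp: Y_def)
  have Y_meas: "Y k \<in> borel_measurable M" if "k \<in> I" for k
    unfolding Y_def by (rule measurable_compose[OF meas[OF that] borel_measurable_torus_arg])
  have Y_int: "integrable M (Y k)" if "k \<in> I" for k
    using Y_bound Y_meas that by (intro integrable_const_bound[where B=pi] AE_I2) auto
  \<comment> \<open>The angle is split into its mean and its centred part, so that a deterministic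
    rotation can be taken out of each expectation.\<close>
  have X_pow: "X k \<omega> powi l = cis (L * m k) * cis (L * (Y k \<omega> - m k))"
    if "k \<in> I" "\<omega> \<in> space M" for k \<omega>
    using torus_arg(3)[OF X_torus[OF that]] cis_power_int[of "Y k \<omega>" l]
    by (simp add: Y_def L_def cis_mult algebra_simps)
  have pow: "(\<lambda>z. z powi l) \<in> borel_measurable torus_borel"
    by (intro borel_measurable_continuous_torus continuous_intros) (auto simp: torus_not_zero)
  have prod: "(\<lambda>\<omega>. \<Prod>k\<in>I. X k \<omega>) \<in> measurable M torus_borel"
    using meas by (rule measurable_prod_torus)
  have prod_powi: "(\<Prod>k\<in>J. f k) powi l = (\<Prod>k\<in>J. f k powi l)" for J :: "'i set" and f :: "'i \<Rightarrow> complex"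
    by (induction J rule: infinite_finite_induct) (auto simp: power_int_mult_distrib)
  have "(\<integral>z. z powi l \<partial>distr M torus_borel (\<lambda>\<omega>. \<Prod>k\<in>I. X k \<omega>)) =
      expectation (\<lambda>\<omega>. \<Prod>k\<in>I. X k \<omega> powi l)"
    by (simp add: integral_distr[OF prod pow] prod_powi)
  also have "\<dots> = (\<Prod>k\<in>I. expectation (\<lambda>\<omega>. X k \<omega> powi l))"
  proof (rule indep_vars_lebesgue_integral[OF \<open>finite I\<close>])
    show "indep_vars (\<lambda>_. borel) (\<lambda>k \<omega>. X k \<omega> powi l) I"
      by (rule indep_vars_compose2[OF indep pow])
    show "integrable M (\<lambda>\<omega>. X k \<omega> powi l)" if "k \<in> I" for k
      using X_torus[OF that] measurable_compose[OF meas[OF that] pow]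
      by (intro integrable_const_bound[where B=1] AE_I2) (auto simp: norm_power_int norm_torus)
  qed
  also have "\<dots> = (\<Prod>k\<in>I. cis (L * m k) * expectation (\<lambda>\<omega>. cis (L * (Y k \<omega> - m k))))"
    by (intro prod.cong refl)
       (simp add: X_pow cong: Bochner_Integration.integral_cong flip: integral_mult_right_zero)
  also have "\<dots> = (\<Prod>k\<in>I. cis (L * m k)) * (\<Prod>k\<in>I. expectation (\<lambda>\<omega>. cis (L * (Y k \<omega> - m k))))"
    by (rule prod.distrib)
  finally have lhs: "(\<integral>z. z powi l \<partial>distr M torus_borel (\<lambda>\<omega>. \<Prod>k\<in>I. X k \<omega>)) =
    (\<Prod>k\<in>I. cis (L * m k)) * (\<Prod>k\<in>I. expectation (\<lambda>\<omega>. cis (L * (Y k \<omega> - m k))))" .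
  have "exp (\<i> * complex_of_real (\<Sum>k\<in>I. m k)) = (\<Prod>k\<in>I. cis (m k))"
    by (simp add: sum_distrib_left exp_sum[OF \<open>finite I\<close>] cis_conv_exp)
  then have rhs1: "exp (\<i> * complex_of_real (\<Sum>k\<in>I. m k)) powi l = (\<Prod>k\<in>I. cis (L * m k))"
    by (simp add: prod_powi cis_power_int L_def)
  have rhs2: "complex_of_real (exp (- (L\<^sup>2 * (\<Sum>k\<in>I. variance (Y k))) / 2)) =
    (\<Prod>k\<in>I. complex_of_real (exp (- (L\<^sup>2 * variance (Y k)) / 2)))"
    by (simp add: sum_distrib_left sum_divide_distrib sum_negf exp_sum[OF \<open>finite I\<close>]
        flip: of_real_prod sum_negf)
  have "cmod ((\<Prod>k\<in>I. cis (L * m k)) * (\<Prod>k\<in>I. expectation (\<lambda>\<omega>. cis (L * (Y k \<omega> - m k)))) -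
      (\<Prod>k\<in>I. cis (L * m k)) * (\<Prod>k\<in>I. complex_of_real (exp (- (L\<^sup>2 * variance (Y k)) / 2))))
    = cmod ((\<Prod>k\<in>I. expectation (\<lambda>\<omega>. cis (L * (Y k \<omega> - m k)))) -
      (\<Prod>k\<in>I. complex_of_real (exp (- (L\<^sup>2 * variance (Y k)) / 2))))"
    by (simp add: norm_mult prod_norm[symmetric] flip: right_diff_distrib)
  also have "\<dots> \<le> (\<Sum>k\<in>I. cmod (expectation (\<lambda>\<omega>. cis (L * (Y k \<omega> - m k))) -
      complex_of_real (exp (- (L\<^sup>2 * variance (Y k)) / 2))))"
  proof (rule norm_prod_diff)
    fix k
    have "cmod (expectation (\<lambda>\<omega>. cis (L * (Y k \<omega> - m k)))) \<le>
        expectation (\<lambda>\<omega>. cmod (cis (L * (Y k \<omega> - m k))))"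
      by (rule integral_norm_bound)
    then show "cmod (expectation (\<lambda>\<omega>. cis (L * (Y k \<omega> - m k)))) \<le> 1"
      by (simp add: prob_space)
    show "cmod (complex_of_real (exp (- (L\<^sup>2 * variance (Y k)) / 2))) \<le> 1"
      by (simp add: norm_of_real del: of_real_exp)
  qed
  also have "\<dots> \<le> (\<Sum>k\<in>I. (\<bar>L\<bar> ^ 3 / 6 + 2 * pi * L ^ 4 / 8) * expectation (\<lambda>\<omega>. \<bar>Y k \<omega> - m k\<bar> ^ 3))"
  proof (rule sum_mono)
    fix k assume k: "k \<in> I"
    have "\<bar>m k\<bar> \<le> expectation (\<lambda>\<omega>. \<bar>Y k \<omega>\<bar>)" unfolding m_def by (rule integral_abs_bound)
    also have "\<dots> \<le> expectation (\<lambda>\<omega>. pi)" using Y_bound Y_int k by (intro integral_mono) auto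
    finally have mk: "\<bar>m k\<bar> \<le> pi" by (simp add: prob_space)
    show "cmod (expectation (\<lambda>\<omega>. cis (L * (Y k \<omega> - m k))) -
        complex_of_real (exp (- (L\<^sup>2 * variance (Y k)) / 2)))
      \<le> (\<bar>L\<bar> ^ 3 / 6 + 2 * pi * L ^ 4 / 8) * expectation (\<lambda>\<omega>. \<bar>Y k \<omega> - m k\<bar> ^ 3)"
      unfolding m_def
    proof (rule char_gauss_approx)
      show "(\<lambda>\<omega>. Y k \<omega> - expectation (Y k)) \<in> borel_measurable M" using Y_meas[OF k] by simp
      show "\<bar>Y k \<omega> - expectation (Y k)\<bar> \<le> 2 * pi" if "\<omega> \<in> space M" for \<omega>
        using Y_bound[OF k that] mk unfolding m_def by linarith
      show "expectation (\<lambda>\<omega>. Y k \<omega> - expectation (Y k)) = 0"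
        using Y_int[OF k] by (simp add: prob_space)
    qed
  qed
  finally show ?thesis
    unfolding lhs L_def[symmetric] m_def[symmetric] rhs1
    unfolding m_def rhs2 by (simp add: sum_distrib_left)
qed

end

section \<open>Infinitesimality and weak convergence of the row products\<close>

theorem theorem6p2:
  fixes M :: "nat \<Rightarrow> 'a measure"
    and K :: "nat \<Rightarrow> nat"
    and X :: "nat \<Rightarrow> nat \<Rightarrow> 'a \<Rightarrow> complex"
    and a :: complex and b :: real
  assumes "\<And>n. n \<ge> 1 \<Longrightarrow> prob_space (M n)"
    and "\<And>n. n \<ge> 1 \<Longrightarrow> K n \<ge> 1"
    and "\<And>n k. n \<ge> 1 \<Longrightarrow> k \<in> {1..K n} \<Longrightarrow> X n k \<in> measurable (M n) torus_borel"
    and "\<And>n. n \<ge> 1 \<Longrightarrow> prob_space.indep_vars (M n) (\<lambda>_. torus_borel) (X n) {1..K n}"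
    and "a \<in> torus" and "b \<ge> 0"
    and "(\<lambda>n. exp (\<i> * complex_of_real
            (\<Sum>k=1..K n. prob_space.expectation (M n) (\<lambda>\<omega>. torus_arg (X n k \<omega>))))) \<longlonglongrightarrow> a"
    and "(\<lambda>n. \<Sum>k=1..K n. prob_space.variance (M n) (\<lambda>\<omega>. torus_arg (X n k \<omega>))) \<longlonglongrightarrow> b"
    and "\<And>\<epsilon>::real. \<epsilon> > 0 \<Longrightarrow>
          (\<lambda>n. \<Sum>k=1..K n. measure (M n) {\<omega>\<in>space (M n). \<bar>torus_arg (X n k \<omega>)\<bar> > \<epsilon>}) \<longlonglongrightarrow> 0"
  shows "torus_infinitesimal M K X \<and>
    torus_weak_conv (\<lambda>n. distr (M n) torus_borel (\<lambda>\<omega>. \<Prod>k=1..K n. X n k \<omega>))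
      (torus_convolution (return torus_borel a) (torus_gauss b))"
proof
  define Y where "Y n k \<omega> = torus_arg (X n k \<omega>)" for n k \<omega>
  define P where "P \<epsilon> n k = measure (M n) {\<omega>\<in>space (M n). \<bar>Y n k \<omega>\<bar> > \<epsilon>}" for \<epsilon> n k
  define m where "m n k = prob_space.expectation (M n) (Y n k)" for n k
  define V where "V n k = prob_space.variance (M n) (Y n k)" for n k
  \<comment> \<open>For \<open>n \<ge> 1\<close>, this sum bounds the distance of each Fourier
    coefficient from its Gaussian counterpart, up to a factor depending only on the
    exponent.\<close>
  define S where "S n = (\<Sum>k=1..K n. prob_space.expectation (M n) (\<lambda>\<omega>. \<bar>Y n k \<omega> - m n k\<bar> ^ 3))" for n
  note prob = assms(1) and meas = assms(3)
  have mean_lim: "(\<lambda>n. exp (\<i> * complex_of_real (\<Sum>k=1..K n. m n k))) \<longlonglongrightarrow> a"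
    using assms(7) by (simp add: m_def Y_def[abs_def])
  have var_lim: "(\<lambda>n. \<Sum>k=1..K n. V n k) \<longlonglongrightarrow> b"
    using assms(8) by (simp add: V_def Y_def[abs_def])
  have P_lim: "(\<lambda>n. \<Sum>k=1..K n. P \<epsilon> n k) \<longlonglongrightarrow> 0" if "\<epsilon> > 0" for \<epsilon>
    using assms(9)[OF that] by (simp add: P_def Y_def)
  have X_torus: "X n k \<omega> \<in> torus" if "n \<ge> 1" "k \<in> {1..K n}" "\<omega> \<in> space (M n)" for n k \<omega>
    using measurable_space[OF meas[OF that(1,2)] that(3)] by simp
  have Y_meas: "Y n k \<in> borel_measurable (M n)" if "n \<ge> 1" "k \<in> {1..K n}" for n k
    unfolding Y_def by (rule measurable_compose[OF meas[OF that] borel_measurable_torus_arg])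
  have Y_bound: "\<bar>Y n k \<omega>\<bar> \<le> pi" if "n \<ge> 1" "k \<in> {1..K n}" "\<omega> \<in> space (M n)" for n k \<omega>
    using torus_arg[OF X_torus[OF that]] by (auto simp: Y_def)
  have P_nonneg: "P \<epsilon> n k \<ge> 0" for \<epsilon> n k by (simp add: P_def)

  \<comment> \<open>Infinitesimality\<close>
  show "torus_infinitesimal M K X"
    unfolding torus_infinitesimal_def
  proof (intro ballI impI)
    fix U assume "U \<in> sets torus_borel" "\<exists>V. openin (top_of_set torus) V \<and> 1 \<in> V \<and> V \<subseteq> U"
    then obtain T where T: "open T" "1 \<in> T" "torus \<inter> T \<subseteq> U"
      by (auto simp: openin_open)
    then obtain r where r: "r > 0" "ball 1 r \<subseteq> T" by (auto simp: open_contains_ball)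
    \<comment> \<open>The chord \<open>cmod (z - 1)\<close> is at most the arc
      \<open>\<bar>torus_arg z\<bar>\<close>, so arguments up to \<open>r / 2\<close> stay strictly
      inside the ball of radius \<open>r\<close>.\<close>
    have near: "z \<in> U" if "z \<in> torus" "\<bar>torus_arg z\<bar> \<le> r / 2" for z
    proof -
      have "cmod (z - 1) \<le> \<bar>torus_arg z\<bar>"
        using iexp_approx1[of "torus_arg z" 0] torus_arg(3)[OF that(1)] by (simp add: cis_conv_exp)
      then have "z \<in> ball 1 r" using that r by (simp add: dist_norm norm_minus_commute)
      then show ?thesis using T r that by auto
    qed
    show "(\<lambda>n. MAX k\<in>{1..K n}. measure (M n) {\<omega>\<in>space (M n). X n k \<omega> \<in> torus - U}) \<longlonglongrightarrow> 0"
    \<comment> \<open>The maximum is at most the sum, which tends to \<open>0\<close> by (iii) with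
      \<open>\<epsilon> = r / 2\<close>.\<close>
    proof (rule tendsto_sandwich[OF _ _ tendsto_const P_lim[of "r / 2"]])
      have bounds: "0 \<le> (MAX k\<in>{1..K n}. measure (M n) {\<omega>\<in>space (M n). X n k \<omega> \<in> torus - U}) \<and>
        (MAX k\<in>{1..K n}. measure (M n) {\<omega>\<in>space (M n). X n k \<omega> \<in> torus - U}) \<le> (\<Sum>k=1..K n. P (r / 2) n k)"
        if n: "n \<ge> 1" for n
      proof -
        interpret prob_space "M n" using n by (rule prob)
        have "prob {\<omega>\<in>space (M n). X n k \<omega> \<in> torus - U} \<le> (\<Sum>k=1..K n. P (r / 2) n k)"
          if k: "k \<in> {1..K n}" for k
        proof -
          note [measurable] = Y_meas[OF n k]
          have "prob {\<omega>\<in>space (M n). X n k \<omega> \<in> torus - U} \<le> P (r / 2) n k"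
            unfolding P_def using near by (intro finite_measure_mono) (force simp: Y_def, measurable)
          also have "\<dots> \<le> (\<Sum>k=1..K n. P (r / 2) n k)"
            using k by (intro member_le_sum P_nonneg) auto
          finally show ?thesis .
        qed
        \<comment> \<open>\<open>MAX\<close> thus ranges over a nonempty finite set, and bounds on
          the members carry over to it.\<close>
        moreover have "1 \<in> {1..K n}" using assms(2)[OF n] by simp
        ultimately show ?thesis
          by (auto simp: Max_ge_iff intro!: Max.boundedI)
      qed
      show "\<forall>\<^sub>F n in sequentially. 0 \<le> (MAX k\<in>{1..K n}. measure (M n) {\<omega>\<in>space (M n). X n k \<omega> \<in> torus - U})"
        and "\<forall>\<^sub>F n in sequentially. (MAX k\<in>{1..K n}. measure (M n) {\<omega>\<in>space (M n). X n k \<omega> \<in> torus - U})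
          \<le> (\<Sum>k=1..K n. P (r / 2) n k)"
        using eventually_ge_at_top[of 1] by (eventually_elim, use bounds in blast)+
    qed (use r in simp)
  qed

  \<comment> \<open>Vanishing of the summed third central moments\<close>
  have S_nonneg: "0 \<le> S n" for n
    by (simp add: S_def sum_nonneg)
  \<comment> \<open>The smallness condition supplies the last hypothesis of
    \<open>third_central_moment_le\<close> with \<open>C = pi\<close>, because each single
    probability is at most the sum.\<close>
  have S_le: "S n \<le> 3 * \<delta> * (\<Sum>k=1..K n. V n k) + (2 * pi) ^ 3 * (\<Sum>k=1..K n. P \<delta> n k)"
    if n: "n \<ge> 1" and \<delta>: "\<delta> > 0" and small: "(\<Sum>k=1..K n. P \<delta> n k) \<le> \<delta> / pi" for n \<delta>
  proof -
    interpret prob_space "M n" using n by (rule prob)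
    have "S n \<le> (\<Sum>k=1..K n. 3 * \<delta> * V n k + (2 * pi) ^ 3 * P \<delta> n k)"
      unfolding S_def
    proof (rule sum_mono)
      fix k assume k: "k \<in> {1..K n}"
      have "P \<delta> n k \<le> (\<Sum>k=1..K n. P \<delta> n k)"
        using k by (intro member_le_sum P_nonneg) auto
      with small have "P \<delta> n k \<le> \<delta> / pi" by linarith
      then have "pi * P \<delta> n k \<le> \<delta>" by (simp add: field_simps)
      then show "expectation (\<lambda>\<omega>. \<bar>Y n k \<omega> - m n k\<bar> ^ 3) \<le> 3 * \<delta> * V n k + (2 * pi) ^ 3 * P \<delta> n k"
        unfolding m_def V_def P_def
        using \<delta> by (intro third_central_moment_le Y_meas[OF n k] Y_bound[OF n k]) auto
    qed
    then show ?thesis by (simp add: sum.distrib sum_distrib_left)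
  qed
  have S_lim: "S \<longlonglongrightarrow> 0"
  proof (rule tendstoI)
    fix e :: real assume "e > 0"
    \<comment> \<open>Chosen so that \<open>3 * \<delta> * (b + 1) = e / 2\<close>, where
      \<open>b + 1\<close> eventually bounds the sum of the variances and is positive even when
      \<open>b = 0\<close>.\<close>
    define \<delta> where "\<delta> = e / (6 * (b + 1))"
    have \<delta>: "\<delta> > 0" using \<open>e > 0\<close> assms(6) by (simp add: \<delta>_def)
    have "\<forall>\<^sub>F n in sequentially. (\<Sum>k=1..K n. V n k) < b + 1"
      using var_lim by (rule order_tendstoD) simp
    \<comment> \<open>This threshold meets the smallness condition of \<open>S_le\<close>; the next
      one makes the remaining term of that bound less than \<open>e / 2\<close>.\<close>
    moreover have "\<forall>\<^sub>F n in sequentially. (\<Sum>k=1..K n. P \<delta> n k) < \<delta> / pi"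
      using P_lim[OF \<delta>] by (rule order_tendstoD) (use \<delta> in simp)
    moreover have "\<forall>\<^sub>F n in sequentially. (\<Sum>k=1..K n. P \<delta> n k) < e / 2 / (2 * pi) ^ 3"
      using P_lim[OF \<delta>] by (rule order_tendstoD) (use \<open>e > 0\<close> in simp)
    ultimately show "\<forall>\<^sub>F n in sequentially. dist (S n) 0 < e"
      using eventually_ge_at_top[of 1]
    proof eventually_elim
      case (elim n)
      have "S n \<le> 3 * \<delta> * (\<Sum>k=1..K n. V n k) + (2 * pi) ^ 3 * (\<Sum>k=1..K n. P \<delta> n k)"
        using elim \<delta> by (intro S_le) auto
      also have "3 * \<delta> * (\<Sum>k=1..K n. V n k) \<le> 3 * \<delta> * (b + 1)"
        using elim \<delta> by (intro mult_left_mono) auto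
      also have "3 * \<delta> * (b + 1) = e / 2"
        using assms(6) by (simp add: \<delta>_def field_simps)
      also have "(2 * pi) ^ 3 * (\<Sum>k=1..K n. P \<delta> n k) < e / 2"
        using elim(3) pi_gt_zero by (simp add: pos_less_divide_eq mult_ac)
      finally show ?case using S_nonneg[of n] by simp
    qed
  qed

  \<comment> \<open>Convergence of the Fourier coefficients\<close>
  show "torus_weak_conv (\<lambda>n. distr (M n) torus_borel (\<lambda>\<omega>. \<Prod>k=1..K n. X n k \<omega>))
      (torus_convolution (return torus_borel a) (torus_gauss b))"
  proof (rule torus_weak_convI)
    note gauss = torus_gauss[OF assms(6)]
    note conv = torus_convolution_return[OF assms(5) gauss(1,2)]
    show "prob_space (torus_convolution (return torus_borel a) (torus_gauss b))"
      "sets (torus_convolution (return torus_borel a) (torus_gauss b)) = sets torus_borel"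
      by (fact conv)+
    show "\<forall>\<^sub>F n in sequentially. prob_space (distr (M n) torus_borel (\<lambda>\<omega>. \<Prod>k=1..K n. X n k \<omega>)) \<and>
        sets (distr (M n) torus_borel (\<lambda>\<omega>. \<Prod>k=1..K n. X n k \<omega>)) = sets torus_borel"
      using eventually_ge_at_top[of 1]
    proof eventually_elim
      case (elim n)
      then show ?case
        by (auto intro!: prob_space.prob_space_distr prob measurable_prod_torus meas)
    qed
    fix l :: int
    define L where "L = real_of_int l"
    \<comment> \<open>The Gaussian counterpart of the \<open>l\<close>-th coefficient. It converges
      by (i) and (ii), where \<open>a \<noteq> 0\<close> gives continuity of \<open>powi\<close> at
      \<open>a\<close> for negative \<open>l\<close> as well.\<close>
    define G where "G n = exp (\<i> * complex_of_real (\<Sum>k=1..K n. m n k)) powi l *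
      complex_of_real (exp (- (L\<^sup>2 * (\<Sum>k=1..K n. V n k)) / 2))" for n
    have "G \<longlonglongrightarrow> a powi l * complex_of_real (exp (- (L\<^sup>2 * b) / 2))"
      unfolding G_def using assms(5)
      by (intro tendsto_intros mean_lim var_lim) (auto simp: torus_not_zero)
    moreover have "(\<lambda>n. (\<integral>z. z powi l \<partial>distr (M n) torus_borel (\<lambda>\<omega>. \<Prod>k=1..K n. X n k \<omega>)) - G n) \<longlonglongrightarrow> 0"
    \<comment> \<open>For fixed \<open>l\<close> the bound of \<open>fourier_prod_approx\<close> is
      a constant times \<open>S n\<close>.\<close>
    proof (rule Lim_null_comparison)
      show "(\<lambda>n. (\<bar>L\<bar> ^ 3 / 6 + 2 * pi * L ^ 4 / 8) * S n) \<longlonglongrightarrow> 0"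
        by (rule tendsto_mult_right_zero[OF S_lim])
      show "\<forall>\<^sub>F n in sequentially.
        norm ((\<integral>z. z powi l \<partial>distr (M n) torus_borel (\<lambda>\<omega>. \<Prod>k=1..K n. X n k \<omega>)) - G n)
          \<le> (\<bar>L\<bar> ^ 3 / 6 + 2 * pi * L ^ 4 / 8) * S n"
        using eventually_ge_at_top[of 1]
      proof eventually_elim
        case (elim n)
        interpret prob_space "M n" using elim by (rule prob)
        show ?case
          using fourier_prod_approx[OF _ meas[OF elim] assms(4)[OF elim], of l]
          by (simp add: G_def S_def L_def m_def V_def Y_def[abs_def])
      qed
    qed
    ultimately have "(\<lambda>n. \<integral>z. z powi l \<partial>distr (M n) torus_borel (\<lambda>\<omega>. \<Prod>k=1..K n. X n k \<omega>))
        \<longlonglongrightarrow> a powi l * complex_of_real (exp (- (L\<^sup>2 * b) / 2))"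
      by (rule Lim_transform)
    also have "a powi l * complex_of_real (exp (- (L\<^sup>2 * b) / 2)) =
        (\<integral>z. z powi l \<partial>torus_convolution (return torus_borel a) (torus_gauss b))"
      by (simp add: conv(3) gauss(3) L_def mult.commute)
    finally show "(\<lambda>n. \<integral>z. z powi l \<partial>distr (M n) torus_borel (\<lambda>\<omega>. \<Prod>k=1..K n. X n k \<omega>))
        \<longlonglongrightarrow> (\<integral>z. z powi l \<partial>torus_convolution (return torus_borel a) (torus_gauss b))" .
  qed
qed

end
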